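(* Let $\mathbf c=(c_1,\dots,c_k)$ be a composition of a positive integer $n$, with diagram $\mathscr D$ and set of labelled lines $\ell(\mathscr D)$. Let $C,C'$ be a pair of neighbouring columns of $\mathscr D$ of height $t$, with $C$ to the left of $C'$. Then there is a unique disjoint union $\mathscr U^t[C,C']$ of composite lines (formed from lines of $\ell(\mathscr D)$ of either label $1$ or $\ast$ joining boxes of $R^t[C,C']$) passing through all the boxes in $R^t[C,C']$.
   Context: Diagram. $\mathscr D$ has columns $C_1,\dots,C_k$ (left to right), all starting in row $R_1$ (rows are numbered $1,2,\dots$ from top to bottom); $C_i$ consists of $c_i$ boxes, in rows $R_1,\dots,R_{c_i}$, and its height is $c_i$. $\mathscr T$ is the tableau obtained by inserting $1,\dots,n$ into the boxes of $\mathscr D$, down the columns and then from left to right over columns; $b(s)$ is the box of $\mathscr D$ labelled $s$ in $\mathscr T$. Columns $C_i,C_j$ with $i<j$ are neighbouring of height $t$ if $c_i=c_j=t$ and no column strictly between them has height $t$; then $C_i$ is the left neighbour of $C_j$. The tableau $\mathscr T(\infty)$. Let $\preceq$ be the total order on $\{1,\dots,n\}$ in which labels of $\mathscr T$ increase strictly down each column and then from right to left over columns (all labels in $C_k$ from top to bottom, then those of $C_{k-1}$ from top to bottom, etc.). Enlarge $\mathscr D$ by allowing arbitrarily many rows in each of the $k$ columns; "height" always refers to $\mathscr D$. Start with $\mathscr T$ and treat the labels one after another in increasing $\preceq$-order. For the current label $l$, repeat: let $R_p\cap C_j$ be the rightmost position currently containing $l$; if $j=k$ stop. If $c_{j+1}<p$: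 when $R_p\cap C_{j+1}$ is empty put $l$ there, otherwise stop. If $c_{j+1}=p$: when $C_{j+1}$ has a left neighbour in $\mathscr D$ and $R_{p+1}\cap C_{j+1}$ is empty put $l$ in $R_{p+1}\cap C_{j+1}$, otherwise stop. If $c_{j+1}>p$ stop. The result after treating all labels is $\mathscr T(\infty)$. The lines $\ell(\mathscr D)$. A line joins a box (its left end point) to a box in a column strictly further right (its right end point) and carries a label $1$ or $\ast$. For each $m\in\{2,\dots,k\}$ put $h=c_m$, and let $r_i$ be the entry of $\mathscr T(\infty)$ in $R_i\cap C_{m-1}$ ($r_i=0$ if empty). The lines of $\ell(\mathscr D)$ with right end point in $C_m$ are exactly: (1) for $1\le i\le h-1$ with $r_i\ne0$, a line labelled $1$ from $b(r_i)$ to $C_m\cap R_i$; (2) if some column to the left of $C_m$ has height $h$: a line labelled $\ast$ from $b(r_h)$ to $C_m\cap R_h$ and, if $r_{h+1}\neq0$, a line labelled $1$ from $b(r_{h+1})$ to $C_m\cap R_h$; (3) if no column to the left of $C_m$ has height $h$ and $r_h\ne0$: a line labelled $1$ from $b(r_h)$ to $C_m\cap R_h$. $R^t[C,C']$ is the set of boxes of $\mathscr D$ lying in rows $R_1,\dots,R_t$ and in the columns from $C$ to $C'$ inclusive. A composite line in $R^t[C,C']$ is a concatenation, going from left to right, of lines of $\ell(\mathscr D)$ joining boxes of $R^t[C,C']$, starting at a box of $C$ and ending at a box of $C'$. Composite lines are disjoint if they do not pass through a common box. A disjoint union of composite lines is a set of pairwise disjoint composite lines. *)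

theory Defs
  imports Main "HOL-Library.Disjoint_Sets"
begin

definition is_composition :: "nat list \<Rightarrow> nat \<Rightarrow> bool" where
  "is_composition c n \<longleftrightarrow> sum_list c = n \<and> (\<forall>h \<in> set c. 0 < h)"

text \<open>A position is a pair (row, column). Rows and columns are numbered from 1.\<close>

type_synonym box = "nat \<times> nat"

definition height :: "nat list \<Rightarrow> nat \<Rightarrow> nat" where
  "height c j = c ! (j - 1)"

definition boxes :: "nat list \<Rightarrow> box set" where
  "boxes c = {(p, j). 1 \<le> j \<and> j \<le> length c \<and> 1 \<le> p \<and> p \<le> height c j}"

definition neighbouring :: "nat list \<Rightarrow> nat \<Rightarrow> nat \<Rightarrow> nat \<Rightarrow> bool" where
  "neighbouring c t i j \<longleftrightarrow>
     1 \<le> i \<and> i < j \<and> j \<le> length c \<and> height c i = t \<and> height c j = t \<and>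
     (\<forall>m. i < m \<and> m < j \<longrightarrow> height c m \<noteq> t)"

definition has_left_neighbour :: "nat list \<Rightarrow> nat \<Rightarrow> bool" where
  "has_left_neighbour c j \<longleftrightarrow> (\<exists>i. neighbouring c (height c j) i j)"

text \<open>A filling assigns an entry to every position of the enlarged diagram
  (arbitrarily many rows in each column). Since labels start at 1, the entry 0 means ``empty''.\<close>

type_synonym filling = "box \<Rightarrow> nat"

definition tableau :: "nat list \<Rightarrow> filling" where
  "tableau c = (\<lambda>(p, j). if (p, j) \<in> boxes c then sum_list (take (j - 1) c) + p else 0)"

definition box_of :: "nat list \<Rightarrow> nat \<Rightarrow> box" where
  "box_of c l = (THE q. q \<in> boxes c \<and> tableau c q = l)"

text \<open>The labels listed increasingly for the order \<open>\<preceq>\<close>: down each column, columns from right to left.\<close>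

definition label_order :: "nat list \<Rightarrow> nat list" where
  "label_order c =
     concat (map (\<lambda>j. map (\<lambda>p. tableau c (p, j)) [1..<Suc (height c j)])
                 (rev [1..<Suc (length c)]))"

text \<open>The arguments \<open>p\<close>, \<open>j\<close> are the row and column of the rightmost position containing \<open>l\<close>.
  Treating other labels never moves \<open>l\<close>, so this is \<open>box_of c l\<close> at the start, and
  afterwards the position filled last.\<close>

function extend_label :: "nat list \<Rightarrow> nat \<Rightarrow> nat \<Rightarrow> nat \<Rightarrow> filling \<Rightarrow> filling" where
  "extend_label c l p j T =
     (if length c \<le> j then T
      else if height c (j + 1) < p then
        (if T (p, j + 1) = 0
         then extend_label c l p (j + 1) (T((p, j + 1) := l)) else T)
      else if height c (j + 1) = p then
        (if has_left_neighbour c (j + 1) \<and> T (p + 1, j + 1) = 0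
         then extend_label c l (p + 1) (j + 1) (T((p + 1, j + 1) := l)) else T)
      else T)"
  by pat_completeness auto
termination
  by (relation "measure (\<lambda>(c, l, p, j, T). length c - j)") auto

declare extend_label.simps [simp del]

definition tableau_inf :: "nat list \<Rightarrow> filling" where
  "tableau_inf c =
     fold (\<lambda>l. extend_label c l (fst (box_of c l)) (snd (box_of c l))) (label_order c) (tableau c)"

datatype line_label = One | Star

text \<open>A line is given by its left end point, its right end point and its label.\<close>

type_synonym line = "box \<times> box \<times> line_label"

abbreviation left_end :: "line \<Rightarrow> box" where
  "left_end e \<equiv> fst e"

abbreviation right_end :: "line \<Rightarrow> box" where
  "right_end e \<equiv> fst (snd e)"

text \<open>The second set carries no condition \<open>r h \<noteq> 0\<close>: when an earlier column has height \<open>h\<close>,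
  position \<open>(h, m - 1)\<close> is always filled in \<open>tableau_inf c\<close>.\<close>

definition lines_into :: "nat list \<Rightarrow> nat \<Rightarrow> line set" where
  "lines_into c m =
     (let h = height c m;
          r = (\<lambda>i. tableau_inf c (i, m - 1));
          repeated = (\<exists>i. 1 \<le> i \<and> i < m \<and> height c i = h)
      in {(box_of c (r i), (i, m), One) | i. 1 \<le> i \<and> i \<le> h - 1 \<and> r i \<noteq> 0}
       \<union> (if repeated then {(box_of c (r h), (h, m), Star)} else {})
       \<union> (if repeated \<and> r (h + 1) \<noteq> 0 then {(box_of c (r (h + 1)), (h, m), One)} else {})
       \<union> (if \<not> repeated \<and> r h \<noteq> 0 then {(box_of c (r h), (h, m), One)} else {}))"

definition lines :: "nat list \<Rightarrow> line set" where
  "lines c = (\<Union>m \<in> {2..length c}. lines_into c m)"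

text \<open>\<open>region c t i j\<close> is $R^t[C_i,C_j]$.\<close>

definition region :: "nat list \<Rightarrow> nat \<Rightarrow> nat \<Rightarrow> nat \<Rightarrow> box set" where
  "region c t i j = {(p, m) \<in> boxes c. p \<le> t \<and> i \<le> m \<and> m \<le> j}"

definition boxes_on :: "line list \<Rightarrow> box set" where
  "boxes_on L = left_end ` set L \<union> right_end ` set L"

text \<open>Composite lines from \<open>C\<^sub>i\<close> to \<open>C\<^sub>j\<close> in $R^t[C_i,C_j]$, as the list of the lines
  concatenated, from left to right.\<close>

definition composite_line :: "nat list \<Rightarrow> nat \<Rightarrow> nat \<Rightarrow> nat \<Rightarrow> line list \<Rightarrow> bool" where
  "composite_line c t i j L \<longleftrightarrow>
     L \<noteq> [] \<and>
     set L \<subseteq> lines c \<and>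
     boxes_on L \<subseteq> region c t i j \<and>
     successively (\<lambda>e e'. right_end e = left_end e') L \<and>
     snd (left_end (hd L)) = i \<and>
     snd (right_end (last L)) = j"

definition disjoint_union_of_composite_lines ::
    "nat list \<Rightarrow> nat \<Rightarrow> nat \<Rightarrow> nat \<Rightarrow> line list set \<Rightarrow> bool" where
  "disjoint_union_of_composite_lines c t i j U \<longleftrightarrow>
     (\<forall>L \<in> U. composite_line c t i j L) \<and> disjoint_family_on boxes_on U"

definition passes_through :: "line list set \<Rightarrow> box set \<Rightarrow> bool" where
  "passes_through U B \<longleftrightarrow> B \<subseteq> (\<Union>L \<in> U. boxes_on L)"

end

theory Submission
  imports Defs
begin

text \<open>
  In rows \<open>1, \<dots>, t\<close> of the columns from \<open>C\<close> up to the one before \<open>C'\<close>, every position of \<open>\<T>(\<infinity>)\<close>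
  is filled, and by a label of a box of the region: no column strictly in between has height \<open>t\<close>,
  so labels neither enter nor leave this strip through its lower edge. A label stays in the strip
  until it either meets a column it cannot pass, or competes with the label in the row next to it
  for the first row below a column with a left neighbour and loses. In both cases it emits a line
  into that column, its final line. Each box outside \<open>C\<close> is the right end of exactly one final line: the only
  boxes with two lines coming from the region are those where two labels compete, and the line of
  the winner is not final. So the final lines match boxes outside \<open>C'\<close> with boxes outside \<open>C\<close>, and
  following them gives the required composite lines.

  Conversely, go through the columns from right to left. If a cover used the line of a winner, then the final
  line of that winner, which ends further right and so already belongs to the cover, would start
  at the same box.
\<close>

section \<open>Path covers determined by their lines\<close>

text \<open>A matching of the boxes outside column \<open>j\<close> with the boxes outside column
  \<open>i\<close>, kept apart from tableaux so that paths can be studied through their lines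
  alone.\<close>

locale perfect_lines =
  fixes B :: "box set" and i j :: nat and M :: "line set"
  assumes ij: "i < j"
    and columns: "v \<in> B \<Longrightarrow> i \<le> snd v \<and> snd v \<le> j"
    and line_ends: "e \<in> M \<Longrightarrow> left_end e \<in> B \<and> right_end e \<in> B"
    and line_increasing: "e \<in> M \<Longrightarrow> snd (left_end e) < snd (right_end e)"
    and in_line: "v \<in> B \<Longrightarrow> i < snd v \<Longrightarrow> \<exists>!e. e \<in> M \<and> right_end e = v"
    and out_line: "v \<in> B \<Longrightarrow> snd v < j \<Longrightarrow> \<exists>!e. e \<in> M \<and> left_end e = v"

abbreviation connected_lines :: "line list \<Rightarrow> bool" where
  "connected_lines \<equiv> successively (\<lambda>e e'. right_end e = left_end e')"

text \<open>The candidate cover, taken as all such lists at once rather than assembled path by path;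
  disjointness and covering then follow from properties of single lines.\<close>

definition full_paths :: "nat \<Rightarrow> nat \<Rightarrow> line set \<Rightarrow> line list set" where
  "full_paths i j M = {L. L \<noteq> [] \<and> set L \<subseteq> M \<and> connected_lines L \<and>
     snd (left_end (hd L)) = i \<and> snd (right_end (last L)) = j}"

section \<open>Lists of connected lines\<close>

lemma connected_linesD:
  assumes "connected_lines (xs @ e # e' # ys)"
  shows "right_end e = left_end e'"
  using assms by (auto simp: successively_append_iff)

text \<open>Consecutive lines share an end point, so the last right end point is the only box of a
  path that may fail to be a left end point.\<close>

lemma boxes_on_left_end:
  assumes "connected_lines L" "L \<noteq> []" "v \<in> boxes_on L" "v \<noteq> right_end (last L)"
  shows "\<exists>e \<in> set L. left_end e = v"
proof -
  consider "v \<in> left_end ` set L" | e where "e \<in> set L" "v = right_end e"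
    using assms(3) unfolding boxes_on_def by blast
  then show ?thesis
  proof cases
    case 1 then show ?thesis by blast
  next
    case 2
    then obtain xs ys where L: "L = xs @ e # ys" by (meson split_list)
    then obtain e' zs where "ys = e' # zs" using assms(4) 2 by (cases ys) auto
    then show ?thesis using connected_linesD[of xs e e' zs] assms(1) L 2 by auto
  qed
qed

lemma boxes_on_right_end:
  assumes "connected_lines L" "L \<noteq> []" "v \<in> boxes_on L" "v \<noteq> left_end (hd L)"
  shows "\<exists>e \<in> set L. right_end e = v"
proof -
  consider "v \<in> right_end ` set L" | e where "e \<in> set L" "v = left_end e"
    using assms(3) unfolding boxes_on_def by blast
  then show ?thesis
  proof cases
    case 1 then show ?thesis by blast
  next
    case 2
    then obtain xs ys where L: "L = xs @ e # ys" by (meson split_list)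
    then obtain e' zs where "xs = zs @ [e']" using assms(4) 2 by (cases xs rule: rev_cases) auto
    then show ?thesis using connected_linesD[of zs e' e ys] assms(1) L 2 by auto
  qed
qed

lemma connected_lines_increasing:
  assumes "connected_lines (xs @ e # ys)"
    and "\<And>f. f \<in> set (xs @ e # ys) \<Longrightarrow> snd (left_end f) < snd (right_end f)"
    and "f \<in> set ys"
  shows "snd (right_end e) \<le> snd (left_end f)"
  using assms
proof (induction ys arbitrary: xs e)
  case (Cons e' ys)
  have eq: "right_end e = left_end e'" using Cons.prems(1) connected_linesD by blast
  show ?case
  proof (cases "f = e'")
    case False
    then have "snd (right_end e') \<le> snd (left_end f)"
      using Cons.IH[of "xs @ [e]" e'] Cons.prems by auto
    moreover have "snd (left_end e') < snd (right_end e')" using Cons.prems(2) by auto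
    ultimately show ?thesis using eq by simp
  qed (use eq in simp)
qed simp

text \<open>Of two different lines on a path, the later one starts no further left than the earlier
  one ends, so they share neither a left nor a right end point.\<close>

lemma connected_lines_unique_ends:
  assumes "connected_lines L"
    and "\<And>f. f \<in> set L \<Longrightarrow> snd (left_end f) < snd (right_end f)"
    and "e \<in> set L" "f \<in> set L" and "left_end e = left_end f \<or> right_end e = right_end f"
  shows "e = f"
proof (rule ccontr)
  assume "e \<noteq> f"
  have *: False
    if "a \<in> set ys" "L = xs @ b # ys" "left_end b = left_end a \<or> right_end b = right_end a"
    for a b xs ys
  proof -
    have "snd (right_end b) \<le> snd (left_end a)"
      by (rule connected_lines_increasing[of xs b ys]) (use assms(1,2) that in blast)+
    moreover have "snd (left_end a) < snd (right_end a)" "snd (left_end b) < snd (right_end b)"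
      using assms(2) that by auto
    ultimately show False using that(3) by auto
  qed
  obtain xs ys where L: "L = xs @ e # ys" using assms(3) by (meson split_list)
  show False
  proof (cases "f \<in> set ys")
    case True then show False using * L assms(5) by blast
  next
    case False
    then have "f \<in> set xs" using assms(4) L \<open>e \<noteq> f\<close> by auto
    then obtain us vs where "xs = us @ f # vs" by (meson split_list)
    then show False using *[of e "vs @ e # ys" us f] L assms(5) by auto
  qed
qed

lemma full_paths_split:
  assumes "xs @ e # ys \<in> full_paths i j M"
  shows "set (xs @ [e]) \<subseteq> M \<and> connected_lines (xs @ [e]) \<and> snd (left_end (hd (xs @ [e]))) = i \<and>
    set (e # ys) \<subseteq> M \<and> connected_lines (e # ys) \<and> snd (right_end (last (e # ys))) = j"
proof -
  have L: "set (xs @ e # ys) \<subseteq> M" "connected_lines (xs @ e # ys)"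
    "snd (left_end (hd (xs @ e # ys))) = i" "snd (right_end (last (xs @ e # ys))) = j"
    using assms unfolding full_paths_def by blast+
  have "hd (xs @ e # ys) = hd (xs @ [e])" "last (xs @ e # ys) = last (e # ys)" by (cases xs) simp_all
  then show ?thesis using L by (simp add: successively_append_iff)
qed

section \<open>Paths through a matching\<close>

context perfect_lines
begin

lemma in_unique: "e \<in> M \<Longrightarrow> f \<in> M \<Longrightarrow> right_end e = right_end f \<Longrightarrow> e = f"
proof -
  assume ef: "e \<in> M" "f \<in> M" "right_end e = right_end f"
  then have "right_end e \<in> B" "i < snd (right_end e)"
    using line_ends[of e] line_increasing[of e] columns[of "left_end e"] by auto
  then show "e = f" using in_line ef by (metis (no_types, lifting))
qed

lemma out_unique: "e \<in> M \<Longrightarrow> f \<in> M \<Longrightarrow> left_end e = left_end f \<Longrightarrow> e = f"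
proof -
  assume ef: "e \<in> M" "f \<in> M" "left_end e = left_end f"
  then have "left_end e \<in> B" "snd (left_end e) < j"
    using line_ends[of e] line_increasing[of e] columns[of "right_end e"] by auto
  then show "e = f" using out_line ef by (metis (no_types, lifting))
qed

text \<open>Follow outgoing lines: columns strictly increase, and only a line ending in column
  \<open>j\<close> has no successor.\<close>

lemma forward_path:
  assumes "e \<in> M"
  shows "\<exists>ys. set (e # ys) \<subseteq> M \<and> connected_lines (e # ys) \<and> snd (right_end (last (e # ys))) = j"
  using assms
proof (induction "j - snd (right_end e)" arbitrary: e rule: less_induct)
  case less
  show ?case
  proof (cases "snd (right_end e) = j")
    case True then show ?thesis using less.prems by (intro exI[of _ "[]"]) auto
  next
    case False
    then have lt: "snd (right_end e) < j"
      using columns line_ends less.prems by (meson le_neq_implies_less)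
    then obtain f where f: "f \<in> M" "left_end f = right_end e"
      using out_line line_ends less.prems by meson
    then have "j - snd (right_end f) < j - snd (right_end e)"
      using line_increasing[of f] lt by auto
    then obtain ys where "set (f # ys) \<subseteq> M" "connected_lines (f # ys)"
      "snd (right_end (last (f # ys))) = j" using less.hyps f by blast
    then show ?thesis using f less.prems by (intro exI[of _ "f # ys"]) auto
  qed
qed

lemma backward_path:
  assumes "e \<in> M"
  shows "\<exists>xs. set (xs @ [e]) \<subseteq> M \<and> connected_lines (xs @ [e]) \<and> snd (left_end (hd (xs @ [e]))) = i"
  using assms
proof (induction "snd (left_end e)" arbitrary: e rule: less_induct)
  case less
  show ?case
  proof (cases "snd (left_end e) = i")
    case True then show ?thesis using less.prems by (intro exI[of _ "[]"]) auto
  next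
    case False
    then have "i < snd (left_end e)"
      using columns line_ends less.prems by (metis le_neq_implies_less)
    then obtain f where f: "f \<in> M" "right_end f = left_end e"
      using in_line line_ends less.prems by meson
    then have "snd (left_end f) < snd (left_end e)" using line_increasing[of f] by auto
    then obtain xs where "set (xs @ [f]) \<subseteq> M" "connected_lines (xs @ [f])"
      "snd (left_end (hd (xs @ [f]))) = i" using less.hyps f by blast
    then show ?thesis using f less.prems
      by (intro exI[of _ "xs @ [f]"]) (auto simp: successively_append_iff hd_append)
  qed
qed

lemma line_on_full_path:
  assumes "e \<in> M"
  shows "\<exists>L \<in> full_paths i j M. e \<in> set L"
proof -
  obtain xs where xs: "set (xs @ [e]) \<subseteq> M" "connected_lines (xs @ [e])"
    "snd (left_end (hd (xs @ [e]))) = i" using backward_path assms by blast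
  obtain ys where ys: "set (e # ys) \<subseteq> M" "connected_lines (e # ys)"
    "snd (right_end (last (e # ys))) = j" using forward_path assms by blast
  have "connected_lines (xs @ e # ys)"
    using xs(2) ys(2) by (auto simp: successively_append_iff)
  moreover have "hd (xs @ e # ys) = hd (xs @ [e])" by (cases xs) auto
  ultimately have "xs @ e # ys \<in> full_paths i j M"
    unfolding full_paths_def using xs ys by simp
  moreover have "e \<in> set (xs @ e # ys)" by simp
  ultimately show ?thesis by blast
qed

lemma boxes_on_full_paths:
  assumes "L \<in> full_paths i j M"
  shows "boxes_on L \<subseteq> B"
  using assms line_ends unfolding full_paths_def boxes_on_def by blast

text \<open>No line leaves column \<open>j\<close>, so neither list can end while the other
  continues, and \<open>out_unique\<close> excludes branching.\<close>

lemma forward_determined: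
  assumes "set (e # ys) \<subseteq> M" "connected_lines (e # ys)" "snd (right_end (last (e # ys))) = j"
    and "set (e # zs) \<subseteq> M" "connected_lines (e # zs)" "snd (right_end (last (e # zs))) = j"
  shows "ys = zs"
  using assms
proof (induction ys arbitrary: e zs)
  case Nil
  show ?case
  proof (cases zs)
    case (Cons f fs)
    then have "f \<in> M" "snd (left_end f) = j" using Nil.prems by simp_all
    then show ?thesis using line_increasing[of f] line_ends[of f] columns[of "right_end f"] by simp
  qed simp
next
  case (Cons a ys)
  show ?case
  proof (cases zs)
    case Nil
    then have "a \<in> M" "snd (left_end a) = j" using Cons.prems by simp_all
    then show ?thesis using line_increasing[of a] line_ends[of a] columns[of "right_end a"] by simp
  next
    case (Cons b bs)
    then have "left_end b = left_end a" "a \<in> M" "b \<in> M" using Cons.prems by simp_all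
    then have "b = a" by (intro out_unique)
    then show ?thesis using Cons.IH[of a bs] Cons.prems \<open>zs = b # bs\<close> by simp
  qed
qed

lemma backward_determined:
  assumes "set (ys @ [e]) \<subseteq> M" "connected_lines (ys @ [e])" "snd (left_end (hd (ys @ [e]))) = i"
    and "set (zs @ [e]) \<subseteq> M" "connected_lines (zs @ [e])" "snd (left_end (hd (zs @ [e]))) = i"
  shows "ys = zs"
  using assms
proof (induction ys arbitrary: e zs rule: rev_induct)
  case Nil
  show ?case
  proof (cases zs rule: rev_cases)
    case (snoc fs f)
    then have "f \<in> M" "snd (right_end f) = i"
      using Nil.prems by (simp_all add: successively_append_iff)
    then show ?thesis using line_increasing[of f] line_ends[of f] columns[of "left_end f"] by simp
  qed simp
next
  case (snoc a ys)
  show ?case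
  proof (cases zs rule: rev_cases)
    case Nil
    then have "a \<in> M" "snd (right_end a) = i"
      using snoc.prems by (simp_all add: successively_append_iff)
    then show ?thesis using line_increasing[of a] line_ends[of a] columns[of "left_end a"] by simp
  next
    case (snoc bs b)
    then have "right_end b = right_end a" "a \<in> M" "b \<in> M"
      using snoc.prems by (simp_all add: successively_append_iff)
    then have "b = a" by (intro in_unique)
    have "hd (xs @ [a, e]) = hd (xs @ [a])" for xs :: "line list" by (cases xs) simp_all
    then have "ys = bs" using snoc.prems \<open>zs = bs @ [b]\<close> \<open>b = a\<close>
      by (intro snoc.IH[of a bs]) (simp_all add: successively_append_iff)
    then show ?thesis using \<open>zs = bs @ [b]\<close> \<open>b = a\<close> by simp
  qed
qed

lemma full_paths_sharing_line:
  assumes "L \<in> full_paths i j M" "L' \<in> full_paths i j M" "e \<in> set L" "e \<in> set L'"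
  shows "L = L'"
proof -
  obtain xs ys where L: "L = xs @ e # ys" using assms(3) by (meson split_list)
  obtain xs' ys' where L': "L' = xs' @ e # ys'" using assms(4) by (meson split_list)
  note * = full_paths_split[OF assms(1)[unfolded L]] full_paths_split[OF assms(2)[unfolded L']]
  have "xs = xs'" by (rule backward_determined[of _ e]) (use * in blast)+
  moreover have "ys = ys'" by (rule forward_determined[of e]) (use * in blast)+
  ultimately show ?thesis using L L' by simp
qed

text \<open>A common box forces a common line: the outgoing one, or in column \<open>j\<close>,
  where nothing goes out, the incoming one.\<close>

lemma full_paths_sharing_box:
  assumes "L \<in> full_paths i j M" "L' \<in> full_paths i j M" "v \<in> boxes_on L" "v \<in> boxes_on L'"
  shows "L = L'"
proof (cases "snd v = j")
  case True
  then have "v \<noteq> left_end (hd L)" "v \<noteq> left_end (hd L')" using assms(1,2) ij unfolding full_paths_def by auto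
  then have "\<exists>e \<in> set L. right_end e = v" "\<exists>e \<in> set L'. right_end e = v"
    using assms boxes_on_right_end[of L v] boxes_on_right_end[of L' v] unfolding full_paths_def by blast+
  then obtain e e' where e: "e \<in> set L" "right_end e = v" "e' \<in> set L'" "right_end e' = v" by blast
  then have "e = e'" using assms(1,2) by (intro in_unique) (auto simp: full_paths_def)
  then show ?thesis using full_paths_sharing_line assms e by blast
next
  case False
  then have "v \<noteq> right_end (last L)" "v \<noteq> right_end (last L')" using assms(1,2) unfolding full_paths_def by auto
  then have "\<exists>e \<in> set L. left_end e = v" "\<exists>e \<in> set L'. left_end e = v"
    using assms boxes_on_left_end[of L v] boxes_on_left_end[of L' v] unfolding full_paths_def by blast+
  then obtain e e' where e: "e \<in> set L" "left_end e = v" "e' \<in> set L'" "left_end e' = v" by blast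
  then have "e = e'" using assms(1,2) by (intro out_unique) (auto simp: full_paths_def)
  then show ?thesis using full_paths_sharing_line assms e by blast
qed

lemma full_paths_cover: "passes_through (full_paths i j M) B"
  unfolding passes_through_def
proof
  fix v assume v: "v \<in> B"
  have "\<exists>e \<in> M. left_end e = v \<or> right_end e = v"
  proof (cases "snd v < j")
    case True then show ?thesis using out_line[OF v] by blast
  next
    case False then have "i < snd v" using ij by simp
    then show ?thesis using in_line[OF v] by blast
  qed
  then obtain e where e: "e \<in> M" "left_end e = v \<or> right_end e = v" by blast
  obtain L where "L \<in> full_paths i j M" "e \<in> set L" using line_on_full_path[OF e(1)] by blast
  moreover from this e have "v \<in> boxes_on L" unfolding boxes_on_def by blast
  ultimately show "v \<in> \<Union> (boxes_on ` full_paths i j M)" by blast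
qed

text \<open>The first line of a full path identifies the path, so containing all lines of
  \<open>M\<close> forces every full path into \<open>U\<close>.\<close>

lemma full_paths_eqI:
  assumes "U \<subseteq> full_paths i j M" "M \<subseteq> \<Union> (set ` U)"
  shows "U = full_paths i j M"
proof
  show "full_paths i j M \<subseteq> U"
  proof
    fix L assume L: "L \<in> full_paths i j M"
    then have "hd L \<in> set L" "hd L \<in> M" unfolding full_paths_def by auto
    then obtain L' where "L' \<in> U" "hd L \<in> set L'" using assms(2) by blast
    then show "L \<in> U" using full_paths_sharing_line[OF L] assms(1) \<open>hd L \<in> set L\<close> by blast
  qed
qed (rule assms(1))

end

section \<open>The fillings occurring in the construction\<close>

lemma boxes_iff:
  "(p, m) \<in> boxes c \<longleftrightarrow> 1 \<le> m \<and> m \<le> length c \<and> 1 \<le> p \<and> p \<le> height c m"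
  by (simp add: boxes_def)

lemma tableau_box:
  "(p, m) \<in> boxes c \<Longrightarrow> tableau c (p, m) = sum_list (take (m - 1) c) + p"
  by (simp add: tableau_def)

lemma tableau_pos: "q \<in> boxes c \<Longrightarrow> 0 < tableau c q"
  by (cases q) (auto simp: tableau_def boxes_def)

lemma sum_list_take_mono: "m \<le> m' \<Longrightarrow> sum_list (take m c) \<le> sum_list (take m' (c :: nat list))"
  by (metis le_add1 sum_list_append take_add le_iff_add)

lemma tableau_less:
  assumes "(p, m) \<in> boxes c" "(p', m') \<in> boxes c" "m < m'"
  shows "tableau c (p, m) < tableau c (p', m')"
proof -
  have m: "1 \<le> m" "m \<le> length c" "p \<le> c ! (m - 1)" "1 \<le> p'"
    using assms by (auto simp: boxes_iff height_def)
  then have "sum_list (take m c) = sum_list (take (m - 1) c) + c ! (m - 1)"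
    using take_Suc_conv_app_nth[of "m - 1" c] by simp
  then have "tableau c (p, m) \<le> sum_list (take m c)" using assms m by (simp add: tableau_box)
  also have "\<dots> \<le> sum_list (take (m' - 1) c)" using assms by (intro sum_list_take_mono) auto
  finally show ?thesis using assms m by (simp add: tableau_box)
qed

lemma tableau_inj: "q \<in> boxes c \<Longrightarrow> q' \<in> boxes c \<Longrightarrow> tableau c q = tableau c q' \<Longrightarrow> q = q'"
proof -
  assume *: "q \<in> boxes c" "q' \<in> boxes c" "tableau c q = tableau c q'"
  obtain p m p' m' where q: "q = (p, m)" "q' = (p', m')" by (cases q; cases q')
  then have "m = m'"
    using * tableau_less[of p m c p' m'] tableau_less[of p' m' c p m] by (cases m m' rule: linorder_cases) auto
  then show "q = q'" using * q by (simp add: tableau_box)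
qed

lemma box_of_tableau: "q \<in> boxes c \<Longrightarrow> box_of c (tableau c q) = q"
  unfolding box_of_def by (rule the_equality) (blast intro: tableau_inj)+

lemma set_label_order: "set (label_order c) = tableau c ` boxes c"
proof -
  have "set (label_order c) = (\<Union>m \<in> {1..length c}. (\<lambda>p. tableau c (p, m)) ` {1..height c m})"
    unfolding label_order_def by (auto simp: atLeastLessThanSuc_atLeastAtMost simp del: upt_Suc)
  also have "\<dots> = tableau c ` boxes c" unfolding boxes_def by force
  finally show ?thesis .
qed

text \<open>The proof uses only the following two properties of \<open>\<T>(\<infinity>)\<close>. In particular, it never matters which
  of two competing labels wins.\<close>

definition inherited :: "nat list \<Rightarrow> filling \<Rightarrow> bool" where
  "inherited c T \<longleftrightarrow> (\<forall>q \<in> boxes c. T q = tableau c q) \<and>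
     (\<forall>p m. T (p, m) \<noteq> 0 \<longrightarrow> (p, m) \<notin> boxes c \<longrightarrow>
        1 < m \<and> m \<le> length c \<and> height c m < p \<and>
        (T (p, m) = T (p, m - 1) \<or>
         p = height c m + 1 \<and> has_left_neighbour c m \<and> T (p, m) = T (p - 1, m - 1)))"

text \<open>A condition on a single position, since during the construction it can fail at boxes
  whose labels have not been treated yet.\<close>

definition extended_at :: "nat list \<Rightarrow> filling \<Rightarrow> box \<Rightarrow> bool" where
  "extended_at c T = (\<lambda>(p, m). T (p, m) \<noteq> 0 \<longrightarrow> m < length c \<longrightarrow>
     (height c (m + 1) < p \<longrightarrow> T (p, m + 1) \<noteq> 0) \<and>
     (height c (m + 1) = p \<and> has_left_neighbour c (m + 1) \<longrightarrow> T (p + 1, m + 1) \<noteq> 0))"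

section \<open>Preservation of the two properties\<close>

lemma inherited_update:
  assumes "inherited c T" "l \<noteq> 0" "T (p, m) = l" "1 \<le> m" "m < length c" "T (p', m + 1) = 0"
    and "height c (m + 1) < p' \<and> p' = p \<or>
      height c (m + 1) = p \<and> p' = p + 1 \<and> has_left_neighbour c (m + 1)"
  shows "inherited c (T((p', m + 1) := l))"
proof -
  let ?T = "T((p', m + 1) := l)"
  \<comment> \<open>Only an empty position is written, so equalities between earlier nonzero entries
    persist.\<close>
  have keep: "T q \<noteq> 0 \<Longrightarrow> ?T q = T q" for q using assms(6) by auto
  have "\<forall>q \<in> boxes c. ?T q = tableau c q"
    using assms(1) keep tableau_pos unfolding inherited_def by (metis less_irrefl)
  moreover have "1 < b \<and> b \<le> length c \<and> height c b < a \<and>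
        (?T (a, b) = ?T (a, b - 1) \<or>
         a = height c b + 1 \<and> has_left_neighbour c b \<and> ?T (a, b) = ?T (a - 1, b - 1))"
    if ab: "?T (a, b) \<noteq> 0" "(a, b) \<notin> boxes c" for a b
  proof (cases "(a, b) = (p', m + 1)")
    case True
    then show ?thesis using assms keep[of "(p, m)"] by auto
  next
    case False
    then have "T (a, b) \<noteq> 0" using ab by auto
    then show ?thesis using assms(1) ab False keep[of "(a, b - 1)"] keep[of "(a - 1, b - 1)"]
      unfolding inherited_def by (metis fun_upd_other)
  qed
  ultimately show ?thesis unfolding inherited_def by blast
qed

text \<open>The condition demands only that certain positions be nonempty, and writing
  \<open>l\<close> can create a new demand only at \<open>q'\<close> itself.\<close>

lemma extended_at_update:
  assumes "extended_at c T q" "q \<noteq> q'" "l \<noteq> 0"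
  shows "extended_at c (T(q' := l)) q"
  using assms unfolding extended_at_def by (auto split: prod.splits)

text \<open>\<open>X\<close> contains the positions that may violate \<open>extended_at\<close>, the
  current position being one further exception. Each recursive call moves this exception to the
  position just filled, and when the label stops the condition holds there too.\<close>

lemma extend_label_invariant:
  assumes "inherited c T" "l \<noteq> 0" "T (p, m) = l" "1 \<le> m"
    and "\<And>q. q \<notin> X \<Longrightarrow> q \<noteq> (p, m) \<Longrightarrow> extended_at c T q"
    and "q \<notin> X \<or> q = (p, m)"
  shows "inherited c (extend_label c l p m T) \<and> extended_at c (extend_label c l p m T) q"
  using assms
proof (induction c l p m T arbitrary: X q rule: extend_label.induct)
  case (1 c l p m T)
  \<comment> \<open>Stopping means that there is no next column, that nothing is demanded there, or
    that the demanded position is filled.\<close>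
  consider (right) "m < length c" "height c (m + 1) < p" "T (p, m + 1) = 0"
    | (down) "m < length c" "height c (m + 1) = p" "has_left_neighbour c (m + 1)"
        "T (p + 1, m + 1) = 0"
    | (stop) "extended_at c T (p, m)" "extend_label c l p m T = T"
    using extend_label.simps[of c l p m T] 
    unfolding extended_at_def by (auto split: if_splits)
  then show ?case
  proof cases
    case right
    let ?T = "T((p, m + 1) := l)"
    have eq: "extend_label c l p m T = extend_label c l p (m + 1) ?T"
      using right by (subst extend_label.simps) auto
    have ext: "extended_at c ?T q'" if "q' \<notin> X - {(p, m)}" "q' \<noteq> (p, m + 1)" for q'
    proof (cases "q' = (p, m)")
      case True then show ?thesis using right 1(4) unfolding extended_at_def by auto
    next
      case False
      then have "extended_at c T q'" using that(1) by (intro 1(7)) auto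
      then show ?thesis using that(2) 1(4) by (rule extended_at_update)
    qed
    have inh: "inherited c ?T" using right 1(3-6) by (intro inherited_update[of c T l p m "p"]) auto
    have "inherited c (extend_label c l p (m + 1) ?T) \<and>
        extended_at c (extend_label c l p (m + 1) ?T) q'"
      if "q' \<notin> X - {(p, m)} \<or> q' = (p, m + 1)" for q'
    proof (rule 1(1)[of "X - {(p, m)}"])
      show "extended_at c ?T q''" if "q'' \<notin> X - {(p, m)}" "q'' \<noteq> (p, m + 1)" for q''
        using ext that .
    qed (use right inh 1(4) that in \<open>auto simp del: fun_upd_apply simp: fun_upd_same\<close>)
    then show ?thesis using eq 1(8) by auto
  next
    case down
    let ?T = "T((p + 1, m + 1) := l)"
    have eq: "extend_label c l p m T = extend_label c l (p + 1) (m + 1) ?T"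
      using down by (subst extend_label.simps) auto
    have ext: "extended_at c ?T q'" if "q' \<notin> X - {(p, m)}" "q' \<noteq> (p + 1, m + 1)" for q'
    proof (cases "q' = (p, m)")
      case True then show ?thesis using down 1(4) unfolding extended_at_def by auto
    next
      case False
      then have "extended_at c T q'" using that(1) by (intro 1(7)) auto
      then show ?thesis using that(2) 1(4) by (rule extended_at_update)
    qed
    have inh: "inherited c ?T" using down 1(3-6) by (intro inherited_update[of c T l p m "p + 1"]) auto
    have "inherited c (extend_label c l (p + 1) (m + 1) ?T) \<and>
        extended_at c (extend_label c l (p + 1) (m + 1) ?T) q'"
      if "q' \<notin> X - {(p, m)} \<or> q' = (p + 1, m + 1)" for q'
    proof (rule 1(2)[of "X - {(p, m)}"])
      show "extended_at c ?T q''" if "q'' \<notin> X - {(p, m)}" "q'' \<noteq> (p + 1, m + 1)" for q''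
        using ext that .
    qed (use down inh 1(4) that in \<open>auto simp del: fun_upd_apply simp: fun_upd_same\<close>)
    then show ?thesis using eq 1(8) by auto
  next
    case stop
    then have "extended_at c T q" using 1(7)[of q] 1(8) by blast
    then show ?thesis using 1(3) stop by simp
  qed
qed

text \<open>Treating a label removes its box from the exceptional set \<open>X\<close>.\<close>

lemma fold_extend_label_invariant:
  assumes "set ls \<subseteq> tableau c ` boxes c" "inherited c T"
    and "\<And>q. q \<notin> X \<Longrightarrow> extended_at c T q" and "q \<notin> X - box_of c ` set ls"
  defines "F \<equiv> fold (\<lambda>l. extend_label c l (fst (box_of c l)) (snd (box_of c l))) ls T"
  shows "inherited c F \<and> extended_at c F q"
  using assms(1-4) unfolding F_def
proof (induction ls arbitrary: T X)
  case (Cons l ls)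
  obtain p m where pm: "(p, m) \<in> boxes c" "l = tableau c (p, m)" using Cons.prems(1) by auto
  then have b: "box_of c l = (p, m)" by (simp add: box_of_tableau)
  let ?T = "extend_label c l p m T"
  have step: "inherited c ?T \<and> extended_at c ?T q'" if "q' \<notin> X \<or> q' = (p, m)" for q'
  proof (rule extend_label_invariant[of _ _ _ _ _ X])
    show "l \<noteq> 0" using pm tableau_pos by (metis less_irrefl)
    show "T (p, m) = l" using Cons.prems(2) pm unfolding inherited_def by auto
    show "1 \<le> m" using pm by (simp add: boxes_iff)
  qed (use Cons.prems that in auto)
  show ?case
    using Cons.IH[of ?T "X - {(p, m)}"] step Cons.prems(1,4) b by auto
qed auto

lemma tableau_inf_invariant: "inherited c (tableau_inf c) \<and> extended_at c (tableau_inf c) q"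
  unfolding tableau_inf_def
\<comment> \<open>Initially only boxes can be exceptional, all other positions being empty, and
  \<open>label_order c\<close> lists the labels of all boxes.\<close>
proof (rule fold_extend_label_invariant[of _ _ _ "boxes c"])
  show "inherited c (tableau c)" unfolding inherited_def by (auto simp: tableau_def)
  show "extended_at c (tableau c) q" if "q \<notin> boxes c" for q
    using that unfolding extended_at_def by (auto simp: tableau_def)
  show "q \<notin> boxes c - box_of c ` set (label_order c)"
    unfolding set_label_order by (auto simp: image_image box_of_tableau)
qed (simp add: set_label_order)

section \<open>The tableau between neighbouring columns\<close>

lemma tableau_inf_box: "q \<in> boxes c \<Longrightarrow> tableau_inf c q = tableau c q"
  using tableau_inf_invariant[of c q] unfolding inherited_def by blast

lemma tableau_inf_inherited:
  assumes "tableau_inf c (p, m) \<noteq> 0" "(p, m) \<notin> boxes c"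
  shows "1 < m" "m \<le> length c" "height c m < p"
    "tableau_inf c (p, m) = tableau_inf c (p, m - 1) \<or>
     p = height c m + 1 \<and> has_left_neighbour c m \<and> tableau_inf c (p, m) = tableau_inf c (p - 1, m - 1)"
  using tableau_inf_invariant[of c] assms unfolding inherited_def by blast+

lemma tableau_inf_extended:
  assumes "tableau_inf c (p, m) \<noteq> 0" "m < length c"
  shows "height c (m + 1) < p \<Longrightarrow> tableau_inf c (p, m + 1) \<noteq> 0"
    and "height c (m + 1) = p \<Longrightarrow> has_left_neighbour c (m + 1) \<Longrightarrow> tableau_inf c (p + 1, m + 1) \<noteq> 0"
  using tableau_inf_invariant[of c "(p, m)"] assms unfolding extended_at_def by auto

section \<open>Tracing a label through the columns\<close>

lemma tableau_inf_origin:
  assumes "tableau_inf c (p, m) \<noteq> 0"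
  shows "\<exists>q \<in> boxes c. tableau c q = tableau_inf c (p, m) \<and> snd q \<le> m \<and> fst q \<le> p"
  using assms
proof (induction m arbitrary: p rule: less_induct)
  case (less m)
  show ?case
  proof (cases "(p, m) \<in> boxes c")
    case True
    then show ?thesis using tableau_inf_box[OF True] by (intro bexI[of _ "(p, m)"]) auto
  next
    case False
    \<comment> \<open>A label enters column \<open>m\<close> from the same row or from the row
      above, so rows never increase when going back to the left.\<close>
    obtain a where a: "a \<le> p" "tableau_inf c (p, m) = tableau_inf c (a, m - 1)"
      using tableau_inf_inherited(4)[OF less.prems False] by (metis diff_le_self le_refl)
    have "1 < m" by (rule tableau_inf_inherited(1)[OF less.prems False])
    then show ?thesis using less.IH[of "m - 1" a] less.prems a by fastforce
  qed
qed

lemma tableau_inf_column_ge: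
  assumes "q \<in> boxes c" "tableau_inf c (p, m) = tableau c q"
  shows "snd q \<le> m"
proof -
  have "tableau_inf c (p, m) \<noteq> 0" using assms tableau_pos[OF assms(1)] by simp
  then obtain q' where "q' \<in> boxes c" "tableau c q' = tableau c q" "snd q' \<le> m"
    using tableau_inf_origin assms(2) by metis
  then show ?thesis using tableau_inj[of q' c q] assms(1) by simp
qed

text \<open>The label of a box of column \<open>m\<close> first appears in that column, whereas this
  one already occurs in column \<open>m - 1\<close>.\<close>

lemma tableau_inf_older_below:
  assumes "tableau_inf c (p, m) = tableau_inf c (p', m - 1)" "tableau_inf c (p, m) \<noteq> 0" "1 \<le> m"
  shows "(p, m) \<notin> boxes c"
proof
  assume b: "(p, m) \<in> boxes c"
  have "m \<le> m - 1"
    using tableau_inf_column_ge[OF b, of p' "m - 1"] tableau_inf_box[OF b] assms(1) by simp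
  then show False using assms(3) by simp
qed

lemma tableau_inf_column_inj:
  assumes "tableau_inf c (p, m) = tableau_inf c (p', m)" "tableau_inf c (p, m) \<noteq> 0"
  shows "p = p'"
  using assms
proof (induction m arbitrary: p p' rule: less_induct)
  case (less m)
  have "1 \<le> m"
    using tableau_inf_inherited(1)[of c p m] less.prems(2) by (fastforce simp: boxes_iff)
  have *: "a = b" if "(a, m) \<notin> boxes c" "tableau_inf c (a, m) = tableau_inf c (b, m)"
    "tableau_inf c (a, m) \<noteq> 0" for a b
  proof -
    note inh = tableau_inf_inherited[OF that(3,1)]
    obtain a' where a': "tableau_inf c (a, m) = tableau_inf c (a', m - 1)"
      "a' = a \<or> a = height c m + 1 \<and> a' = a - 1" using inh(4) by blast
    have nb: "(b, m) \<notin> boxes c"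
      using tableau_inf_older_below[of c b m a'] that(2,3) a'(1) \<open>1 \<le> m\<close> by simp
    have nz: "tableau_inf c (b, m) \<noteq> 0" using that by simp
    note inh' = tableau_inf_inherited[OF nz nb]
    obtain b' where b': "tableau_inf c (b, m) = tableau_inf c (b', m - 1)"
      "b' = b \<or> b = height c m + 1 \<and> b' = b - 1" using inh'(4) by blast
    \<comment> \<open>The source rows agree by induction. Inherited entries lie below row
      \<open>height c m\<close>, so from this source row a label only moves down, and from deeper
      rows it only stays; hence the source row determines the target row.\<close>
    have "a' = b'" using less.IH[of "m - 1" a' b'] inh(1) a'(1) b'(1) that(2,3) by simp
    then show "a = b" using a'(2) b'(2) inh(3) inh'(3) by auto
  qed
  consider "(p, m) \<in> boxes c" "(p', m) \<in> boxes c" | "(p, m) \<notin> boxes c" | "(p', m) \<notin> boxes c"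
    by blast
  then show ?case
  proof cases
    case 1
    then show ?thesis using less.prems(1) tableau_inj by (fastforce simp: tableau_inf_box)
  next
    case 2
    then show ?thesis using *[of p p'] less.prems by simp
  next
    case 3
    then show ?thesis using *[of p' p] less.prems by simp
  qed
qed

lemma height_pos: "\<forall>h \<in> set c. 0 < h \<Longrightarrow> 1 \<le> m \<Longrightarrow> m \<le> length c \<Longrightarrow> 0 < height c m"
  unfolding height_def by simp

text \<open>Induction on the column: a position below the column is filled because the same row of
  the previous column is, and its label comes from that row or the one above, which is still at
  least row 1 because heights are positive.\<close>

lemma neighbouring_strip_filled:
  assumes "\<forall>h \<in> set c. 0 < h" "neighbouring c t i j" "i \<le> m" "m < j" "1 \<le> p" "p \<le> t"
  shows "tableau_inf c (p, m) \<noteq> 0 \<and>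
    (\<exists>q \<in> boxes c. tableau c q = tableau_inf c (p, m) \<and> i \<le> snd q)"
  using assms(3-6)
proof (induction m arbitrary: p rule: dec_induct)
  case base
  then have "(p, i) \<in> boxes c" using assms(2) unfolding neighbouring_def boxes_iff by auto
  then show ?case using tableau_inf_box[of "(p, i)" c] tableau_pos[of "(p, i)" c]
    by (intro conjI bexI[of _ "(p, i)"]) auto
next
  case (step m)
  have m: "Suc m \<le> length c" "1 \<le> i" using assms(2) step.prems unfolding neighbouring_def by auto
  show ?case
  proof (cases "(p, Suc m) \<in> boxes c")
    case True
    then show ?thesis using tableau_inf_box[of "(p, Suc m)" c] tableau_pos[of "(p, Suc m)" c] step.hyps
      by (intro conjI bexI[of _ "(p, Suc m)"]) auto
  next
    case False
    then have p: "height c (Suc m) < p" using step.prems m by (simp add: boxes_iff)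
    have "tableau_inf c (p, m) \<noteq> 0" using step.IH[of p] step.prems by auto
    then have nz: "tableau_inf c (p, Suc m) \<noteq> 0" using tableau_inf_extended(1)[of c p m] m p by auto
    have "0 < height c (Suc m)" using height_pos[OF assms(1)] m by simp
    then have "1 \<le> p - 1" "p - 1 \<le> t" using p step.prems by auto
    then obtain a where "1 \<le> a" "a \<le> t" "tableau_inf c (p, Suc m) = tableau_inf c (a, m)"
      using tableau_inf_inherited(4)[OF nz False] step.prems by (metis diff_Suc_1)
    then show ?thesis using step.IH[of a] step.prems by auto
  qed
qed

section \<open>Lines described by rows\<close>

lemma has_left_neighbour_iff:
  assumes "m \<le> length c"
  shows "has_left_neighbour c m \<longleftrightarrow> (\<exists>i. 1 \<le> i \<and> i < m \<and> height c i = height c m)"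
proof
  assume "\<exists>i. 1 \<le> i \<and> i < m \<and> height c i = height c m"
  then have ne: "{i. 1 \<le> i \<and> i < m \<and> height c i = height c m} \<noteq> {}" (is "?S \<noteq> {}") by blast
  have fin: "finite ?S" by (rule finite_subset[of _ "{..<m}"]) auto
  \<comment> \<open>The left neighbour is the last earlier column of the same height.\<close>
  define k where "k = Max ?S"
  have i: "k \<in> ?S" and max: "\<And>i'. i' \<in> ?S \<Longrightarrow> i' \<le> k"
    unfolding k_def using Max_in[OF fin ne] Max_ge[OF fin] by blast+
  have "height c m' \<noteq> height c m" if "k < m'" "m' < m" for m'
  proof
    assume "height c m' = height c m"
    then have "m' \<in> ?S" using that i by simp
    then show False using max[of m'] that by simp
  qed
  then have "neighbouring c (height c m) k m"
    unfolding neighbouring_def using i assms by simp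
  then show "has_left_neighbour c m" unfolding has_left_neighbour_def by blast
qed (auto simp: has_left_neighbour_def neighbouring_def)

text \<open>Row \<open>p\<close> of column \<open>m - 1\<close> gives a line to row \<open>p\<close> of \<open>C\<^sub>m\<close>, or one row up if \<open>p\<close> is the first
  row below a column with a left neighbour; the minimum merges these cases.\<close>

definition row_line :: "nat list \<Rightarrow> nat \<Rightarrow> nat \<Rightarrow> line" where
  "row_line c p m = (box_of c (tableau_inf c (p, m - 1)), (min p (height c m), m),
     if p = height c m \<and> has_left_neighbour c m then Star else One)"

definition row_has_line :: "nat list \<Rightarrow> nat \<Rightarrow> nat \<Rightarrow> bool" where
  "row_has_line c p m \<longleftrightarrow> 1 \<le> p \<and>
     (p \<le> height c m \<or> p = height c m + 1 \<and> has_left_neighbour c m)"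

lemma lines_into_eq:
  assumes "\<forall>h \<in> set c. 0 < h" "2 \<le> m" "m \<le> length c"
  shows "lines_into c m =
    {row_line c p m | p. row_has_line c p m \<and> tableau_inf c (p, m - 1) \<noteq> 0}"
proof -
  have h: "0 < height c m" using height_pos assms by simp
  \<comment> \<open>\<open>lines_into\<close> puts no nonzero condition on the starred line; the
    filled strip from the left neighbour up to column \<open>m - 1\<close> supplies it.\<close>
  have filled: "tableau_inf c (height c m, m - 1) \<noteq> 0" if rep: "has_left_neighbour c m"
  proof -
    obtain i where i: "neighbouring c (height c m) i m"
      using rep unfolding has_left_neighbour_def by blast
    then have "i < m" unfolding neighbouring_def by blast
    then show ?thesis using neighbouring_strip_filled[OF assms(1) i, of "m - 1" "height c m"] h by simp
  qed
  let ?h = "height c m" and ?F = "\<lambda>p. tableau_inf c (p, m - 1)"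
  have low: "row_line c p m = (box_of c (?F p), (p, m), One)" if "p < ?h" for p
    using that by (simp add: row_line_def)
  have rows: "row_has_line c p m \<longleftrightarrow>
      1 \<le> p \<and> p < ?h \<or> p = ?h \<or> has_left_neighbour c m \<and> p = ?h + 1" for p
    using h unfolding row_has_line_def by (cases "has_left_neighbour c m") auto
  have "{p. row_has_line c p m \<and> ?F p \<noteq> 0} = {p. 1 \<le> p \<and> p < ?h \<and> ?F p \<noteq> 0}
      \<union> (if ?F ?h \<noteq> 0 then {?h} else {})
      \<union> (if has_left_neighbour c m \<and> ?F (?h + 1) \<noteq> 0 then {?h + 1} else {})"
    unfolding rows by auto
  then have "{row_line c p m | p. row_has_line c p m \<and> ?F p \<noteq> 0} =
      (\<lambda>p. row_line c p m) ` {p. 1 \<le> p \<and> p < ?h \<and> ?F p \<noteq> 0}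
      \<union> (if ?F ?h \<noteq> 0 then {row_line c ?h m} else {})
      \<union> (if has_left_neighbour c m \<and> ?F (?h + 1) \<noteq> 0 then {row_line c (?h + 1) m} else {})"
    by (simp only: setcompr_eq_image image_Un if_distrib[of "image _"] image_insert image_empty)
  moreover have "(\<lambda>p. row_line c p m) ` {p. 1 \<le> p \<and> p < ?h \<and> ?F p \<noteq> 0} =
      (\<lambda>p. (box_of c (?F p), (p, m), One)) ` {p. 1 \<le> p \<and> p \<le> ?h - 1 \<and> ?F p \<noteq> 0}"
    using low h by (intro image_cong) auto
  ultimately show ?thesis
    unfolding lines_into_def Let_def has_left_neighbour_iff[OF assms(3), symmetric]
    using filled
    by (cases "has_left_neighbour c m") (simp_all add: row_line_def setcompr_eq_image)
qed

section \<open>Labels in the strip between the two columns\<close>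

locale neighbouring_columns =
  fixes c :: "nat list" and t i j :: nat
  assumes pos: "\<forall>h \<in> set c. 0 < h" and nb: "neighbouring c t i j"
begin

abbreviation entry :: "nat \<Rightarrow> nat \<Rightarrow> nat" where
  "entry p m \<equiv> tableau_inf c (p, m)"

abbreviation R :: "box set" where
  "R \<equiv> region c t i j"

text \<open>The label of \<open>u\<close> still occurs in the strip in column \<open>m\<close>. Column \<open>j\<close> is excluded by
  convention, so that every line into \<open>C\<^sub>j\<close> counts as final.\<close>

definition alive :: "nat \<Rightarrow> box \<Rightarrow> bool" where
  "alive m u \<longleftrightarrow> m < j \<and> (\<exists>p \<in> {1..t}. entry p m = tableau c u)"

text \<open>Finality is tested in column \<open>m\<close> alone: by \<open>alive_downward\<close> a
  label lost there never returns to the strip.\<close>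

definition final_lines :: "line set" where
  "final_lines = {row_line c p m | p m. i < m \<and> m \<le> j \<and> 1 \<le> p \<and> p \<le> t \<and> row_has_line c p m \<and>
     \<not> alive m (left_end (row_line c p m))}"

lemma bounds: "1 \<le> i" "i < j" "j \<le> length c" "height c i = t" "height c j = t" "0 < t"
  and height_between: "i < m \<Longrightarrow> m < j \<Longrightarrow> height c m \<noteq> t"
proof -
  show *: "1 \<le> i" "i < j" "j \<le> length c" "height c i = t" "height c j = t"
    "i < m \<Longrightarrow> m < j \<Longrightarrow> height c m \<noteq> t"
    using nb unfolding neighbouring_def by blast+
  then show "0 < t" using height_pos[OF pos, of i] by simp
qed

lemma region_iff: "(p, m) \<in> R \<longleftrightarrow> 1 \<le> p \<and> p \<le> t \<and> p \<le> height c m \<and> i \<le> m \<and> m \<le> j"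
  using bounds unfolding region_def by (auto simp: boxes_iff)

lemma region_boxes: "q \<in> R \<Longrightarrow> q \<in> boxes c"
  unfolding region_def by auto

lemma strip_nonzero: "i \<le> m \<Longrightarrow> m < j \<Longrightarrow> 1 \<le> p \<Longrightarrow> p \<le> t \<Longrightarrow> entry p m \<noteq> 0"
  using neighbouring_strip_filled[OF pos nb] by blast

text \<open>One origin is known to lie in column \<open>i\<close> or later, another in row at most
  \<open>p\<close> and column at most \<open>m\<close>; bearing the same label, they are the same
  box.\<close>

lemma strip_origin:
  assumes "i \<le> m" "m < j" "1 \<le> p" "p \<le> t"
  shows "\<exists>q \<in> R. tableau c q = entry p m \<and> snd q \<le> m"
proof -
  have nz: "entry p m \<noteq> 0" using strip_nonzero assms by blast
  obtain q where q: "q \<in> boxes c" "tableau c q = entry p m" "i \<le> snd q"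
    using neighbouring_strip_filled[OF pos nb assms] by blast
  obtain q' where q': "q' \<in> boxes c" "tableau c q' = entry p m" "snd q' \<le> m" "fst q' \<le> p"
    using tableau_inf_origin[OF nz] by blast
  have "q' = q" using tableau_inj[OF q'(1) q(1)] q(2) q'(2) by simp
  then have "q \<in> R" using q q' assms unfolding region_def by auto
  then show ?thesis using q q' \<open>q' = q\<close> by blast
qed

text \<open>A label could leave the strip only by a downward step out of row \<open>t\<close>, which
  needs a column of height \<open>t\<close> strictly between the two neighbours.\<close>

lemma strip_row:
  assumes "q \<in> R" "entry p m = tableau c q" "m < j"
  shows "1 \<le> p \<and> p \<le> t"
  using assms(2,3)
proof (induction m arbitrary: p rule: less_induct)
  case (less m)
  have nz: "entry p m \<noteq> 0" using less.prems tableau_pos[OF region_boxes[OF assms(1)]] by simp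
  show ?case
  proof (cases "(p, m) \<in> boxes c")
    case True
    then have "(p, m) = q"
      using less.prems(1) tableau_inf_box[OF True] by (intro tableau_inj[OF True region_boxes[OF assms(1)]]) simp
    then show ?thesis using assms(1) region_iff by blast
  next
    case False
    note inh = tableau_inf_inherited[OF nz False]
    obtain a where a: "entry p m = entry a (m - 1)" "a = p \<or> p = height c m + 1 \<and> a = p - 1"
      using inh(4) by blast
    have row: "1 \<le> a" "a \<le> t" using less.IH[of "m - 1" a] inh(1) a(1) less.prems by simp_all
    \<comment> \<open>The label already occurs in column \<open>m - 1\<close>, so column
      \<open>m\<close> is strictly right of column \<open>i\<close>, as
      \<open>height_between\<close> requires.\<close>
    have "snd q \<le> m - 1"
      using tableau_inf_column_ge[OF region_boxes[OF assms(1)], of a "m - 1"] a(1) less.prems(1) by simp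
    then have "i < m" using assms(1) inh(1) unfolding region_def by auto
    then have "height c m \<noteq> t" using height_between less.prems(2) by blast
    then show ?thesis using a(2) row by auto
  qed
qed

text \<open>A label occupies only one row of column \<open>m - 1\<close>, so the source of its entry
  in column \<open>m\<close> must be the given row \<open>p\<close>.\<close>

lemma entry_step:
  assumes "i < m" "m < j" "1 \<le> p" "p \<le> t" "entry p' m = entry p (m - 1)"
  shows "height c m < p' \<and> (p' = p \<or> p' = height c m + 1 \<and> p = height c m \<and> has_left_neighbour c m)"
proof -
  have nz: "entry p (m - 1) \<noteq> 0" using strip_nonzero assms by auto
  then have "(p', m) \<notin> boxes c" using tableau_inf_older_below[OF assms(5)] assms by simp
  note inh = tableau_inf_inherited[OF _ this]
  obtain a where a: "entry p' m = entry a (m - 1)"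
    "a = p' \<or> p' = height c m + 1 \<and> has_left_neighbour c m \<and> a = p' - 1"
    using inh(4) nz assms(5) by auto
  have "p = a" using tableau_inf_column_inj[of c p "m - 1" a] a(1) assms(5) nz by simp
  then show ?thesis using a(2) inh(3) nz assms(5) by auto
qed

text \<open>A row without a line into the column lies below it and is not the target of a downward
  step.\<close>

lemma entry_pass:
  assumes "i < m" "m < j" "1 \<le> p" "p \<le> t" "\<not> row_has_line c p m"
  shows "entry p m = entry p (m - 1)"
proof -
  have p: "height c m < p" "\<not> (p = height c m + 1 \<and> has_left_neighbour c m)"
    using assms unfolding row_has_line_def by auto
  have nz: "entry p m \<noteq> 0" using strip_nonzero assms by simp
  have "(p, m) \<notin> boxes c" using p by (simp add: boxes_iff)
  then show ?thesis using tableau_inf_inherited(4)[OF nz] p by blast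
qed

lemma entry_below_repeated:
  assumes "i < m" "m < j" "height c m < t" "has_left_neighbour c m"
  shows "entry (height c m + 1) m = entry (height c m) (m - 1) \<or>
    entry (height c m + 1) m = entry (height c m + 1) (m - 1)"
proof -
  have nz: "entry (height c m + 1) m \<noteq> 0" using strip_nonzero assms by simp
  have "(height c m + 1, m) \<notin> boxes c" by (simp add: boxes_iff)
  then show ?thesis using tableau_inf_inherited(4)[OF nz] by auto
qed

lemma row_line_left_end:
  assumes "i < m" "m \<le> j" "1 \<le> p" "p \<le> t"
  shows "left_end (row_line c p m) \<in> R"
    and "tableau c (left_end (row_line c p m)) = entry p (m - 1)"
    and "snd (left_end (row_line c p m)) < m"
proof -
  have "i \<le> m - 1" "m - 1 < j" using assms by auto
  then obtain q where q: "q \<in> R" "tableau c q = entry p (m - 1)" "snd q \<le> m - 1"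
    using strip_origin[of "m - 1" p] assms(3,4) by blast
  then have "left_end (row_line c p m) = q"
    using box_of_tableau[OF region_boxes[OF q(1)]] by (simp add: row_line_def)
  then show "left_end (row_line c p m) \<in> R" "tableau c (left_end (row_line c p m)) = entry p (m - 1)"
    "snd (left_end (row_line c p m)) < m" using q assms by auto
qed

lemma row_line_right_end: "right_end (row_line c p m) = (min p (height c m), m)"
  by (simp add: row_line_def)

lemma row_line_right_end_region:
  assumes "i < m" "m \<le> j" "1 \<le> p" "p \<le> t"
  shows "right_end (row_line c p m) \<in> R"
  using assms bounds height_pos[OF pos, of m] by (auto simp: row_line_right_end region_iff)

text \<open>The right end bounds only \<open>min p (height c m)\<close>; that \<open>p\<close>
  itself is at most \<open>t\<close> comes from the left end through \<open>strip_row\<close>. This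
  rules out the line from row \<open>t + 1\<close> into column \<open>j\<close>.\<close>

lemma lines_in_region:
  assumes "e \<in> lines c" "left_end e \<in> R" "right_end e \<in> R"
  shows "\<exists>p m. e = row_line c p m \<and> i < m \<and> m \<le> j \<and> 1 \<le> p \<and> p \<le> t \<and> row_has_line c p m"
proof -
  obtain m where m: "2 \<le> m" "m \<le> length c" "e \<in> lines_into c m"
    using assms(1) unfolding lines_def by auto
  then obtain p where p: "e = row_line c p m" "row_has_line c p m" "entry p (m - 1) \<noteq> 0"
    using lines_into_eq[OF pos m(1,2)] by blast
  have r: "min p (height c m) \<le> t" "m \<le> j"
    using assms(3) p(1) by (auto simp: row_line_right_end region_iff)
  obtain q where q: "q \<in> boxes c" "tableau c q = entry p (m - 1)" "snd q \<le> m - 1"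
    using tableau_inf_origin[OF p(3)] by blast
  then have "left_end e = q" using box_of_tableau[OF q(1)] p(1) by (simp add: row_line_def)
  then have qR: "q \<in> R" using assms(2) by simp
  then have "i \<le> snd q" unfolding region_def by auto
  moreover have "p \<le> t" using strip_row[OF qR, of p "m - 1"] q(2) r(2) m(1) by simp
  ultimately show ?thesis using p(1,2) r(2) q(3) m(1)
    by (intro exI[of _ p] exI[of _ m]) (auto simp: row_has_line_def)
qed

lemma row_line_in_lines:
  assumes "i < m" "m \<le> j" "1 \<le> p" "p \<le> t" "row_has_line c p m"
  shows "row_line c p m \<in> lines c"
proof -
  have "2 \<le> m" "m \<le> length c" using assms bounds by auto
  moreover have "entry p (m - 1) \<noteq> 0" using strip_nonzero assms by simp
  ultimately have "row_line c p m \<in> lines_into c m" using lines_into_eq[OF pos, of m] assms(5) by blast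
  then show ?thesis using \<open>2 \<le> m\<close> \<open>m \<le> length c\<close> unfolding lines_def by auto
qed

text \<open>An entry outside its own box is inherited from the column before, and
  \<open>strip_row\<close> places that earlier occurrence in the strip.\<close>

lemma alive_downward:
  assumes "alive m' u" "u \<in> R" "snd u \<le> m" "m \<le> m'"
  shows "alive m u"
  using assms(4,3)
proof (induction rule: inc_induct)
  case base
  then show ?case using assms(1) by simp
next
  case (step m)
  obtain p where p: "entry p (Suc m) = tableau c u" "Suc m < j"
    using step.IH step.prems unfolding alive_def by auto
  have nz: "entry p (Suc m) \<noteq> 0" using p(1) tableau_pos[OF region_boxes[OF assms(2)]] by simp
  have "(p, Suc m) \<notin> boxes c"
  proof
    assume b: "(p, Suc m) \<in> boxes c"
    then have "(p, Suc m) = u"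
      using p(1) tableau_inf_box[OF b] by (intro tableau_inj[OF b region_boxes[OF assms(2)]]) simp
    then show False using step.prems by auto
  qed
  then obtain a where a: "entry a m = tableau c u"
    using tableau_inf_inherited(4)[OF nz] p(1) by auto
  then show ?case using strip_row[OF assms(2) a] p(2) unfolding alive_def by auto
qed

section \<open>Final lines form a matching\<close>

lemma final_lineE:
  assumes "e \<in> final_lines"
  obtains p m where "e = row_line c p m" "i < m" "m \<le> j" "1 \<le> p" "p \<le> t" "row_has_line c p m"
    "\<not> alive m (left_end (row_line c p m))"
  using assms unfolding final_lines_def by blast

lemma alive_left_end_iff:
  assumes "i < m" "m \<le> j" "1 \<le> p" "p \<le> t"
  shows "alive m (left_end (row_line c p m)) \<longleftrightarrow> m < j \<and> (\<exists>p' \<in> {1..t}. entry p' m = entry p (m - 1))"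
  unfolding alive_def using row_line_left_end(2)[OF assms] by simp

lemma final_line_into:
  assumes "(r, m) \<in> R" "i < m"
  shows "\<exists>e \<in> final_lines. right_end e = (r, m)"
proof -
  let ?h = "height c m"
  have r: "1 \<le> r" "r \<le> t" "r \<le> ?h" "m \<le> j" using assms(1) by (auto simp: region_iff)
  have "\<exists>p. 1 \<le> p \<and> p \<le> t \<and> min p ?h = r \<and> row_has_line c p m \<and>
      \<not> alive m (left_end (row_line c p m))"
  proof (cases "m < j \<and> r = ?h \<and> has_left_neighbour c m")
    case False
    have "\<not> alive m (left_end (row_line c r m))"
    proof
      assume "alive m (left_end (row_line c r m))"
      then obtain p' where "m < j" "entry p' m = entry r (m - 1)"
        using alive_left_end_iff[OF assms(2) r(4,1,2)] by blast
      then show False using entry_step[OF assms(2) _ r(1,2)] False r by fastforce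
    qed
    then show ?thesis using r by (intro exI[of _ r]) (simp add: row_has_line_def)
  next
    case True
    then have h: "?h < t" using height_between[OF assms(2)] r by auto
    \<comment> \<open>The row of the losing competitor: the row below the column if the label from
      the last row won, and the last row otherwise.\<close>
    define p where "p = (if entry (?h + 1) m = entry ?h (m - 1) then ?h + 1 else ?h)"
    have p: "1 \<le> p" "p \<le> t" "p = ?h \<or> p = ?h + 1" using True h r by (auto simp: p_def)
    have "\<not> alive m (left_end (row_line c p m))"
    proof
      assume "alive m (left_end (row_line c p m))"
      then obtain p' where p': "entry p' m = entry p (m - 1)"
        using alive_left_end_iff[OF assms(2) r(4) p(1,2)] by blast
      then have "p' = ?h + 1" using entry_step[OF assms(2) _ p(1,2) p'] p(3) True by auto
      moreover have "entry ?h (m - 1) \<noteq> entry (?h + 1) (m - 1)"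
        using tableau_inf_column_inj[of c ?h "m - 1" "?h + 1"] strip_nonzero[of "m - 1" ?h] assms(2) True r
        by auto
      ultimately show False
        using p' entry_below_repeated[OF assms(2) _ h] True unfolding p_def by (auto split: if_splits)
    qed
    then show ?thesis using p True by (intro exI[of _ p]) (auto simp: row_has_line_def)
  qed
  then obtain p where p: "1 \<le> p" "p \<le> t" "min p ?h = r" "row_has_line c p m"
    "\<not> alive m (left_end (row_line c p m))" by blast
  then have "row_line c p m \<in> final_lines" unfolding final_lines_def using assms(2) r(4) by blast
  then show ?thesis using p(3) row_line_right_end[of p m] by (intro bexI) auto
qed

text \<open>Different rows lead to the same box only if they are \<open>h\<close> and
  \<open>h + 1\<close>, before a repeated column of height \<open>h\<close>. Both being in the strip
  gives \<open>h < t\<close>, so the column is not \<open>j\<close>, and the label that won the row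
  below is alive.\<close>

lemma final_lines_right_end_inj:
  assumes "e \<in> final_lines" "e' \<in> final_lines" "right_end e = right_end e'"
  shows "e = e'"
proof -
  obtain p m where p: "e = row_line c p m" "i < m" "m \<le> j" "1 \<le> p" "p \<le> t" "row_has_line c p m"
    "\<not> alive m (left_end (row_line c p m))" using final_lineE[OF assms(1)] .
  obtain p' m' where p': "e' = row_line c p' m'" "1 \<le> p'" "p' \<le> t" "row_has_line c p' m'"
    "\<not> alive m' (left_end (row_line c p' m'))" using final_lineE[OF assms(2)] by metis
  let ?h = "height c m"
  have m: "m' = m" and eq: "min p ?h = min p' ?h"
    using assms(3) p(1) p'(1) by (auto simp: row_line_right_end)
  have "p = p'"
  proof (rule ccontr)
    assume "p \<noteq> p'"
    then have hh: "{p, p'} = {?h, ?h + 1}" "has_left_neighbour c m"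
      using p(6) p'(4) eq unfolding m row_has_line_def by auto
    then have "?h < t" using p(5) p'(3) by (metis doubleton_eq_iff less_eq_Suc_le Suc_eq_plus1)
    then have "m < j" using p(3) bounds(5) by (metis le_neq_implies_less less_irrefl)
    then have "\<exists>a \<in> {p, p'}. entry (?h + 1) m = entry a (m - 1)"
      using entry_below_repeated[OF p(2) _ \<open>?h < t\<close> hh(2)] unfolding hh(1) by blast
    then show False
      using alive_left_end_iff[OF p(2-5)] alive_left_end_iff[OF p(2,3) p'(2,3)] p(7) p'(5) \<open>m < j\<close> \<open>?h < t\<close>
      unfolding m by auto
  qed
  then show ?thesis using p(1) p'(1) m by simp
qed

lemma alive_own_column: "u \<in> R \<Longrightarrow> snd u < j \<Longrightarrow> alive (snd u) u"
  using tableau_inf_box[OF region_boxes, of u] region_iff[of "fst u" "snd u"]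
  unfolding alive_def by (auto intro!: bexI[of _ "fst u"])

lemma final_line_from:
  assumes "u \<in> R" "snd u < j"
  shows "\<exists>e \<in> final_lines. left_end e = u"
proof -
  \<comment> \<open>The first column to the right of \<open>u\<close> where its label is gone from
    the strip; it exists because \<open>alive\<close> is false in column \<open>j\<close>.\<close>
  define m where "m = (LEAST m. snd u < m \<and> \<not> alive m u)"
  have ex: "snd u < j \<and> \<not> alive j u" using assms(2) unfolding alive_def by simp
  have m: "snd u < m" "\<not> alive m u" using LeastI[of "\<lambda>m. snd u < m \<and> \<not> alive m u", OF ex] unfolding m_def by auto
  have "m \<le> j" unfolding m_def by (rule Least_le) (rule ex)
  have im: "i < m" using assms(1) m(1) unfolding region_def by auto
  have "alive (m - 1) u"
  proof (cases "snd u = m - 1")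
    case True
    then show ?thesis using alive_own_column[OF assms] by simp
  next
    case False
    then show ?thesis
      using not_less_Least[of "m - 1" "\<lambda>m. snd u < m \<and> \<not> alive m u"] m(1) unfolding m_def[symmetric] by auto
  qed
  then obtain p where p: "1 \<le> p" "p \<le> t" "entry p (m - 1) = tableau c u"
    unfolding alive_def by auto
  have left: "left_end (row_line c p m) = u"
    using p(3) box_of_tableau[OF region_boxes[OF assms(1)]] by (simp add: row_line_def)
  have "row_has_line c p m"
  proof (rule ccontr)
    assume no: "\<not> row_has_line c p m"
    \<comment> \<open>Every row of the strip has a line into column \<open>j\<close>, whose height
      is \<open>t\<close>.\<close>
    then have "m < j" using \<open>m \<le> j\<close> bounds(5) p unfolding row_has_line_def by (metis le_neq_implies_less)
    then have "alive m u" using entry_pass[OF im _ p(1,2) no] p unfolding alive_def by auto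
    then show False using m(2) by simp
  qed
  then have "row_line c p m \<in> final_lines"
    unfolding final_lines_def using im \<open>m \<le> j\<close> p left m(2) by blast
  then show ?thesis using left by blast
qed

lemma alive_before_line:
  assumes "i < m" "m \<le> j" "1 \<le> p" "p \<le> t" "m' < m" "snd (left_end (row_line c p m)) \<le> m'"
  shows "alive m' (left_end (row_line c p m))"
proof -
  have "alive (m - 1) (left_end (row_line c p m))"
    unfolding alive_def row_line_left_end(2)[OF assms(1-4)] using assms(1-4) by auto
  then show ?thesis
    by (rule alive_downward) (use row_line_left_end(1)[OF assms(1-4)] assms in auto)
qed

text \<open>A label is alive in every column from its box up to the one before any line it emits,
  and dead where a final line ends. So both lines end in the same column, and the label has only one
  row in the column before.\<close>

lemma final_lines_left_end_inj:
  assumes "e \<in> final_lines" "e' \<in> final_lines" "left_end e = left_end e'"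
  shows "e = e'"
proof -
  obtain p m where p: "e = row_line c p m" "i < m" "m \<le> j" "1 \<le> p" "p \<le> t"
    "\<not> alive m (left_end (row_line c p m))" using final_lineE[OF assms(1)] by metis
  obtain p' m' where p': "e' = row_line c p' m'" "i < m'" "m' \<le> j" "1 \<le> p'" "p' \<le> t"
    "\<not> alive m' (left_end (row_line c p' m'))" using final_lineE[OF assms(2)] by metis
  have eq: "left_end (row_line c p m) = left_end (row_line c p' m')" using assms(3) p(1) p'(1) by simp
  have "\<not> m' < m"
    using alive_before_line[OF p(2-5), of m'] row_line_left_end(3)[OF p'(2-5)] p'(6) unfolding eq by auto
  moreover have "\<not> m < m'"
    using alive_before_line[OF p'(2-5), of m] row_line_left_end(3)[OF p(2-5)] p(6) unfolding eq by auto
  ultimately have m: "m = m'" by simp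
  have "entry p (m - 1) = entry p' (m - 1)"
    using row_line_left_end(2)[OF p(2-5)] row_line_left_end(2)[OF p'(2-5)] eq m by simp
  then have "p = p'"
    using tableau_inf_column_inj[of c p "m - 1" p'] strip_nonzero[of "m - 1" p] p(2-5) by auto
  then show ?thesis using p(1) p'(1) m by simp
qed

sublocale perfect_lines R i j final_lines
proof
  show "i < j" by (rule bounds)
  show "i \<le> snd v \<and> snd v \<le> j" if "v \<in> R" for v using that unfolding region_def by auto
  show "left_end e \<in> R \<and> right_end e \<in> R" if "e \<in> final_lines" for e
    using that by (elim final_lineE) (simp add: row_line_left_end row_line_right_end_region)
  show "snd (left_end e) < snd (right_end e)" if "e \<in> final_lines" for e
    using that by (elim final_lineE) (simp add: row_line_left_end row_line_right_end)
  show "\<exists>!e. e \<in> final_lines \<and> right_end e = v" if "v \<in> R" "i < snd v" for v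
    using final_line_into[of "fst v" "snd v"] final_lines_right_end_inj that by (metis prod.collapse)
  show "\<exists>!e. e \<in> final_lines \<and> left_end e = v" if "v \<in> R" "snd v < j" for v
    using final_line_from[OF that] final_lines_left_end_inj by metis
qed

section \<open>Uniqueness of the cover\<close>

lemma full_paths_final_lines:
  "disjoint_union_of_composite_lines c t i j (full_paths i j final_lines)"
proof -
  have "final_lines \<subseteq> lines c" unfolding final_lines_def using row_line_in_lines by blast
  then have "composite_line c t i j L" if "L \<in> full_paths i j final_lines" for L
    using that boxes_on_full_paths[OF that] unfolding full_paths_def composite_line_def by blast
  then show ?thesis
    unfolding disjoint_union_of_composite_lines_def disjoint_family_on_def
    using full_paths_sharing_box by blast
qed

section \<open>Lines of an arbitrary cover\<close>

context
  fixes U :: "line list set"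
  assumes U: "disjoint_union_of_composite_lines c t i j U" "passes_through U R"
begin

lemma composite: "L \<in> U \<Longrightarrow> composite_line c t i j L"
  using U(1) unfolding disjoint_union_of_composite_lines_def by blast

lemma cover_line:
  assumes "L \<in> U" "e \<in> set L"
  shows "\<exists>p m. e = row_line c p m \<and> i < m \<and> m \<le> j \<and> 1 \<le> p \<and> p \<le> t \<and> row_has_line c p m"
  using composite[OF assms(1)] assms(2) unfolding composite_line_def boxes_on_def
  by (intro lines_in_region) auto

lemma cover_line_increasing:
  assumes "L \<in> U" "e \<in> set L"
  shows "snd (left_end e) < snd (right_end e)"
  using cover_line[OF assms] row_line_left_end(3) by (auto simp: row_line_right_end)

lemma cover_same_path:
  assumes "L \<in> U" "L' \<in> U" "v \<in> boxes_on L" "v \<in> boxes_on L'"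
  shows "L = L'"
  using assms U(1) unfolding disjoint_union_of_composite_lines_def disjoint_family_on_def by blast

text \<open>A shared end point is a shared box, so both lines lie on one path, where columns
  strictly increase.\<close>

lemma cover_line_unique:
  assumes "L \<in> U" "L' \<in> U" "e \<in> set L" "e' \<in> set L'"
    and "left_end e = left_end e' \<or> right_end e = right_end e'"
  shows "e = e'"
proof -
  have "\<exists>v. v \<in> boxes_on L \<and> v \<in> boxes_on L'"
    using assms(3-5) unfolding boxes_on_def by (metis UnI1 UnI2 image_eqI)
  then have "L' = L" using cover_same_path assms(1,2) by blast
  have conn: "connected_lines L" using composite[OF assms(1)] unfolding composite_line_def by blast
  show ?thesis
    by (rule connected_lines_unique_ends[OF conn])
      (use assms \<open>L' = L\<close> cover_line_increasing in blast)+
qed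

lemma cover_line_into:
  assumes "v \<in> R" "i < snd v"
  shows "\<exists>e \<in> \<Union> (set ` U). right_end e = v"
proof -
  obtain L where L: "L \<in> U" "v \<in> boxes_on L" using U(2) assms(1) unfolding passes_through_def by blast
  then have "connected_lines L" "L \<noteq> []" "v \<noteq> left_end (hd L)"
    using composite[OF L(1)] assms(2) unfolding composite_line_def by auto
  then show ?thesis using boxes_on_right_end[of L v] L by blast
qed

text \<open>Descending induction on the column of the right end: if the left end of a line of the cover
  survives in the column of its right end, then its final line ends further right, hence already
  belongs to the cover.\<close>

lemma cover_line_final:
  assumes "L \<in> U" "e \<in> set L"
  shows "e \<in> final_lines"
  using assms
proof (induction "j - snd (right_end e)" arbitrary: e L rule: less_induct)
  case less
  obtain p m where p: "e = row_line c p m" "i < m" "m \<le> j" "1 \<le> p" "p \<le> t" "row_has_line c p m"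
    using cover_line[OF less.prems] by blast
  note u = row_line_left_end[OF p(2-5), folded p(1)]
  have me: "snd (right_end e) = m" using p(1) row_line_right_end by simp
  show ?case
  proof (rule ccontr)
    assume "e \<notin> final_lines"
    then have al: "alive m (left_end e)" using p unfolding final_lines_def by blast
    then have "m < j" unfolding alive_def by blast
    obtain f where f: "f \<in> final_lines" "left_end f = left_end e"
      using final_line_from[OF u(1)] u(3) \<open>m < j\<close> by auto
    obtain p' m' where p': "f = row_line c p' m'" "i < m'" "m' \<le> j" "1 \<le> p'" "p' \<le> t"
      "\<not> alive m' (left_end f)" using final_lineE[OF f(1)] by metis
    have mf: "snd (right_end f) = m'" using p'(1) row_line_right_end by simp
    have "snd (left_end e) < m'" using row_line_left_end(3)[OF p'(2-5)] p'(1) f(2) by simp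
    \<comment> \<open>The label is alive in column \<open>m\<close> and dead in column
      \<open>m'\<close>, and it cannot return once dead.\<close>
    then have "m < m'"
      using alive_downward[OF al u(1), of m'] p'(6) f(2) by (cases "m < m'") auto
    \<comment> \<open>The cover must enter the box where \<open>f\<close> ends. The line
      \<open>g\<close> doing so ends further right than \<open>e\<close>, so it is final by
      induction and equals \<open>f\<close>.\<close>
    obtain L' g where g: "L' \<in> U" "g \<in> set L'" "right_end g = right_end f"
      using cover_line_into[of "right_end f"] line_ends[OF f(1)] mf p'(2) by auto
    have "g \<in> final_lines" using less.hyps[of g L'] g mf me \<open>m < m'\<close> p'(3) by auto
    then have "g = f" using final_lines_right_end_inj f(1) g(3) by blast
    then have "e = f" using cover_line_unique[OF less.prems(1) g(1) less.prems(2) g(2)] f(2) by simp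
    then show False using me mf \<open>m < m'\<close> by simp
  qed
qed

lemma cover_eq_full_paths: "U = full_paths i j final_lines"
proof (rule full_paths_eqI)
  show "U \<subseteq> full_paths i j final_lines"
    using composite cover_line_final unfolding full_paths_def composite_line_def by blast
  show "final_lines \<subseteq> \<Union> (set ` U)"
  proof
    fix e assume e: "e \<in> final_lines"
    then have "right_end e \<in> R" "i < snd (right_end e)"
      using line_ends[OF e] line_increasing[OF e] columns[of "left_end e"] by auto
    then obtain f L where f: "L \<in> U" "f \<in> set L" "right_end f = right_end e"
      using cover_line_into by blast
    then have "f = e" by (intro final_lines_right_end_inj cover_line_final e)
    then show "e \<in> \<Union> (set ` U)" using f by blast
  qed
qed

end

end

theorem theorem5p8:
  fixes c :: "nat list" and n t i j :: nat
  assumes "n > 0" and "is_composition c n"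
    and "neighbouring c t i j"
  shows "\<exists>!U. disjoint_union_of_composite_lines c t i j U \<and>
              passes_through U (region c t i j)"
proof -
  interpret neighbouring_columns c t i j
    using assms(2,3) by unfold_locales (auto simp: is_composition_def)
  show ?thesis
  proof (rule ex1I)
    show "disjoint_union_of_composite_lines c t i j (full_paths i j final_lines) \<and>
        passes_through (full_paths i j final_lines) R"
      using full_paths_final_lines full_paths_cover by simp
  qed (use cover_eq_full_paths in blast)
qed

end
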